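(* Let $n,m\ge 1$, $N=2^n$, and let $L=\sum_{c=0}^{N-1}|c\rangle\langle c|\otimes U_c$ be an rUCG with $n$ control qubits, $m$ target qubits and target operator family $\mathcal U$ (so $U_c\in\mathcal U$ for all $c$). Then $L$ can be decomposed as a product of $2^n-1$ gates of type CU, a single gate of type U, and $2^n-2$ CNOT gates.
   Context: A uniformly controlled gate (UCG) with $n$ control qubits and $m$ target qubits is a unitary $\sum_{c=0}^{N-1}|c\rangle\langle c|\otimes U_c$, $N=2^n$, where $|c\rangle$ runs over the computational basis of the control register and each $U_c$ is a unitary on the $m$-qubit target register. It is a restricted UCG (rUCG) with target operator family $\mathcal U$ if all $U_c\in\mathcal U$, where $\mathcal U$ is a subgroup of the unitary group on the $m$ target qubits that is (R1) Abelian and (R2) 2-divisible: for every $U\in\mathcal U$ there is $V\in\mathcal U$ with $V^2=U$. Gate types (the gates act on the $n$ control and $m$ target qubits): a gate of type U applies some $V\in\mathcal U$ to the target register unconditionally; a gate of type CU applies some $V\in\mathcal U$ to the target register conditioned on a single qubit being in state $|1\rangle$. Elements of $\mathcal U$ and their singly-controlled versions are treated as indivisible unit gates. *)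

theory Defs
  imports "Jordan_Normal_Form.Schur_Decomposition" "HOL-Algebra.Group"
begin

definition unitary_group :: "nat \<Rightarrow> complex mat monoid" where
  "unitary_group d =
     \<lparr>carrier = {A \<in> carrier_mat d d. mat_adjoint A * A = 1\<^sub>m d \<and> A * mat_adjoint A = 1\<^sub>m d},
      monoid.mult = (*), one = 1\<^sub>m d\<rparr>"

definition tensor_mat :: "complex mat \<Rightarrow> complex mat \<Rightarrow> complex mat" (infixr "\<Otimes>" 75) where
  "A \<Otimes> B = mat (dim_row A * dim_row B) (dim_col A * dim_col B)
     (\<lambda>(i, j). A $$ (i div dim_row B, j div dim_col B) * B $$ (i mod dim_row B, j mod dim_col B))"

text \<open>The operator \<open>|c><c|\<close> on a space of dimension \<open>d\<close>.\<close>

definition basis_proj :: "nat \<Rightarrow> nat \<Rightarrow> complex mat" where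
  "basis_proj d c = mat d d (\<lambda>(i, j). if i = c \<and> j = c then 1 else 0)"

definition ucg :: "nat \<Rightarrow> nat \<Rightarrow> (nat \<Rightarrow> complex mat) \<Rightarrow> complex mat" where
  "ucg n m U = finsum (module_mat TYPE(complex) (2 ^ (n + m)) (2 ^ (n + m)))
     (\<lambda>c. basis_proj (2 ^ n) c \<Otimes> U c) {0..<2 ^ n}"

text \<open>The operator families allowed as targets of a restricted gate: Abelian, 2-divisible
  subgroups of the unitary group on \<open>m\<close> qubits.\<close>

definition target_family :: "nat \<Rightarrow> complex mat set \<Rightarrow> bool" where
  "target_family m \<U> \<longleftrightarrow>
     subgroup \<U> (unitary_group (2 ^ m)) \<and>
     (\<forall>A\<in>\<U>. \<forall>B\<in>\<U>. A * B = B * A) \<and>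
     (\<forall>A\<in>\<U>. \<exists>V\<in>\<U>. V * V = A)"

text \<open>Qubits are numbered from the left: in a register of \<open>q\<close> qubits, qubit \<open>0\<close> is the most
  significant bit of the basis label \<open>x < 2 ^ q\<close>. As the control register is the left tensor
  factor, qubits \<open>0, \<dots>, n - 1\<close> of the whole register are the control qubits and qubits
  \<open>n, \<dots>, n + m - 1\<close> the target qubits.\<close>

definition qubit :: "nat \<Rightarrow> nat \<Rightarrow> nat \<Rightarrow> bool" where
  "qubit q x k = bit x (q - 1 - k)"

definition flip_qubit :: "nat \<Rightarrow> nat \<Rightarrow> nat \<Rightarrow> nat" where
  "flip_qubit q k x = flip_bit (q - 1 - k) x"

text \<open>Projection onto the states of a \<open>q\<close>-qubit register whose qubit \<open>k\<close> has value \<open>b\<close>.\<close>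

definition qubit_proj :: "nat \<Rightarrow> nat \<Rightarrow> bool \<Rightarrow> complex mat" where
  "qubit_proj q k b = mat (2 ^ q) (2 ^ q) (\<lambda>(i, j). if i = j \<and> qubit q j k = b then 1 else 0)"

text \<open>\<open>CU k V\<close> is controlled by the control qubit \<open>k\<close>; \<open>CNOT a b\<close> has control \<open>a\<close> and target \<open>b\<close>,
  which may be any two distinct qubits of the whole register.\<close>

datatype gate = is_UG: UG "complex mat" | is_CU: CU nat "complex mat" | is_CNOT: CNOT nat nat

fun valid_gate :: "nat \<Rightarrow> nat \<Rightarrow> complex mat set \<Rightarrow> gate \<Rightarrow> bool" where
  "valid_gate n m \<U> (UG V) \<longleftrightarrow> V \<in> \<U>"
| "valid_gate n m \<U> (CU k V) \<longleftrightarrow> k < n \<and> V \<in> \<U>"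
| "valid_gate n m \<U> (CNOT a b) \<longleftrightarrow> a < n + m \<and> b < n + m \<and> a \<noteq> b"

fun gate_mat :: "nat \<Rightarrow> nat \<Rightarrow> gate \<Rightarrow> complex mat" where
  "gate_mat n m (UG V) = 1\<^sub>m (2 ^ n) \<Otimes> V"
| "gate_mat n m (CU k V) = qubit_proj n k False \<Otimes> 1\<^sub>m (2 ^ m) + qubit_proj n k True \<Otimes> V"
| "gate_mat n m (CNOT a b) = mat (2 ^ (n + m)) (2 ^ (n + m))
     (\<lambda>(i, j). if i = (if qubit (n + m) j a then flip_qubit (n + m) b j else j) then 1 else 0)"

definition circuit_mat :: "nat \<Rightarrow> nat \<Rightarrow> gate list \<Rightarrow> complex mat" where
  "circuit_mat n m gs = foldr (\<lambda>g A. gate_mat n m g * A) gs (1\<^sub>m (2 ^ (n + m)))"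

lemma mat_adjoint_index:
  assumes "A \<in> carrier_mat r c" "i < c" "j < r"
  shows "mat_adjoint A $$ (i, j) = cnj (A $$ (j, i))"
  using assms unfolding mat_adjoint_def by (simp add: mat_of_rows_def)

lemma mat_adjoint_carrier:
  assumes "A \<in> carrier_mat r c"
  shows "mat_adjoint A \<in> carrier_mat c r"
  using assms unfolding mat_adjoint_def by auto

lemma mat_adjoint_mult:
  fixes A B :: "complex mat"
  assumes A: "A \<in> carrier_mat d d" and B: "B \<in> carrier_mat d d"
  shows "mat_adjoint (A * B) = mat_adjoint B * mat_adjoint A"
proof (rule eq_matI)
  note c = mat_adjoint_carrier[OF A] mat_adjoint_carrier[OF B]
  have AB: "A * B \<in> carrier_mat d d" using A B by simp
  fix i j
  assume "i < dim_row (mat_adjoint B * mat_adjoint A)" "j < dim_col (mat_adjoint B * mat_adjoint A)"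
  then have ij: "i < d" "j < d" using c by auto
  have "mat_adjoint (A * B) $$ (i, j) = (\<Sum>k = 0..<d. cnj (A $$ (j, k)) * cnj (B $$ (k, i)))"
    using mat_adjoint_index[OF AB ij] ij A B by (simp add: scalar_prod_def)
  also have "\<dots> = (\<Sum>k = 0..<d. mat_adjoint B $$ (i, k) * mat_adjoint A $$ (k, j))"
    using mat_adjoint_index[OF A] mat_adjoint_index[OF B] ij
    by (intro sum.cong) (auto simp: mult.commute)
  also have "\<dots> = (mat_adjoint B * mat_adjoint A) $$ (i, j)"
    using c ij by (auto simp: scalar_prod_def)
  finally show "mat_adjoint (A * B) $$ (i, j) = (mat_adjoint B * mat_adjoint A) $$ (i, j)" .
qed (use mat_adjoint_carrier[OF A] mat_adjoint_carrier[OF B] mat_adjoint_carrier[of "A * B" d d] A B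
     in auto)

lemma mat_adjoint_one: "mat_adjoint (1\<^sub>m d :: complex mat) = 1\<^sub>m d"
  using mat_adjoint_index[of "1\<^sub>m d :: complex mat" d d] mat_adjoint_carrier[of "1\<^sub>m d :: complex mat" d d]
  by (intro eq_matI) auto

lemma mat_adjoint_adjoint:
  fixes A :: "complex mat"
  assumes A: "A \<in> carrier_mat d d"
  shows "mat_adjoint (mat_adjoint A) = A"
  using mat_adjoint_index[OF A] mat_adjoint_index[OF mat_adjoint_carrier[OF A]]
    mat_adjoint_carrier[OF mat_adjoint_carrier[OF A]] A
  by (intro eq_matI) auto

lemma group_unitary_group: "group (unitary_group d)"
proof (rule groupI)
  fix A B
  assume "A \<in> carrier (unitary_group d)" "B \<in> carrier (unitary_group d)"
  then have A: "A \<in> carrier_mat d d" "mat_adjoint A * A = 1\<^sub>m d" "A * mat_adjoint A = 1\<^sub>m d"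
    and B: "B \<in> carrier_mat d d" "mat_adjoint B * B = 1\<^sub>m d" "B * mat_adjoint B = 1\<^sub>m d"
    by (auto simp: unitary_group_def)
  note c = A(1) B(1) mat_adjoint_carrier[OF A(1)] mat_adjoint_carrier[OF B(1)]
  have "mat_adjoint B * mat_adjoint A * (A * B) = mat_adjoint B * (mat_adjoint A * A * B)"
    using c by (simp add: assoc_mult_mat[of _ d d _ d _ d])
  moreover have "A * B * (mat_adjoint B * mat_adjoint A) = A * (B * mat_adjoint B * mat_adjoint A)"
    using c by (simp add: assoc_mult_mat[of _ d d _ d _ d])
  ultimately show "A \<otimes>\<^bsub>unitary_group d\<^esub> B \<in> carrier (unitary_group d)"
    using A B c by (simp add: unitary_group_def mat_adjoint_mult)
next
  show "\<one>\<^bsub>unitary_group d\<^esub> \<in> carrier (unitary_group d)"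
    by (simp add: unitary_group_def mat_adjoint_one)
next
  fix A assume A: "A \<in> carrier (unitary_group d)"
  then have "mat_adjoint A \<in> carrier (unitary_group d)"
    using mat_adjoint_carrier[of A d d] mat_adjoint_adjoint[of A d] by (auto simp: unitary_group_def)
  then show "\<exists>B\<in>carrier (unitary_group d). B \<otimes>\<^bsub>unitary_group d\<^esub> A = \<one>\<^bsub>unitary_group d\<^esub>"
    using A by (intro bexI[of _ "mat_adjoint A"]) (auto simp: unitary_group_def)
qed (auto simp: unitary_group_def assoc_mult_mat[of _ d d _ d _ d])

lemma tensor_mat_carrier:
  assumes "A \<in> carrier_mat r c" "B \<in> carrier_mat r' c'"
  shows "A \<Otimes> B \<in> carrier_mat (r * r') (c * c')"
  using assms by (auto simp: tensor_mat_def)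

lemma gate_mat_carrier:
  assumes "\<U> \<subseteq> carrier_mat (2 ^ m) (2 ^ m)" "valid_gate n m \<U> g"
  shows "gate_mat n m g \<in> carrier_mat (2 ^ (n + m)) (2 ^ (n + m))"
  using assms by (cases g) (auto simp: tensor_mat_def qubit_proj_def power_add)

lemma ucg_carrier:
  assumes "\<And>c. c < 2 ^ n \<Longrightarrow> U c \<in> carrier_mat (2 ^ m) (2 ^ m)"
  shows "ucg n m U \<in> carrier_mat (2 ^ (n + m)) (2 ^ (n + m))"
proof -
  interpret abelian_group "module_mat TYPE(complex) (2 ^ (n + m)) (2 ^ (n + m))"
    by (rule abelian_group_mat)
  have "basis_proj (2 ^ n) c \<Otimes> U c \<in> carrier_mat (2 ^ (n + m)) (2 ^ (n + m))" if "c < 2 ^ n" for c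
    using tensor_mat_carrier[of "basis_proj (2 ^ n) c", OF _ assms[OF that]]
    by (simp add: basis_proj_def power_add)
  then show ?thesis
    using finsum_closed[of "\<lambda>c. basis_proj (2 ^ n) c \<Otimes> U c" "{0..<2 ^ n}"]
    by (auto simp: ucg_def module_mat_simps)
qed

text \<open>A uniformly controlled gate is block diagonal with blocks \<open>U 0, \<dots>, U (2 ^ n - 1)\<close>.\<close>

lemma ucg_index:
  assumes U: "\<And>c. c < 2 ^ n \<Longrightarrow> U c \<in> carrier_mat (2 ^ m) (2 ^ m)"
    and ij: "i < 2 ^ (n + m)" "j < 2 ^ (n + m)"
  shows "ucg n m U $$ (i, j) =
    (if i div 2 ^ m = j div 2 ^ m then U (i div 2 ^ m) $$ (i mod 2 ^ m, j mod 2 ^ m) else 0)"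
proof -
  let ?M = "module_mat TYPE(complex) (2 ^ (n + m)) (2 ^ (n + m))"
  let ?f = "\<lambda>c. basis_proj (2 ^ n) c \<Otimes> U c"
  interpret abelian_group ?M by (rule abelian_group_mat)
  have f: "?f c \<in> carrier_mat (2 ^ (n + m)) (2 ^ (n + m))" if "c < 2 ^ n" for c
    using tensor_mat_carrier[of "basis_proj (2 ^ n) c", OF _ U[OF that]]
    by (simp add: basis_proj_def power_add)
  have "finsum ?M ?f F \<in> carrier_mat (2 ^ (n + m)) (2 ^ (n + m)) \<and>
      finsum ?M ?f F $$ (i, j) = (\<Sum>c\<in>F. ?f c $$ (i, j))" if "F \<subseteq> {0..<2 ^ n}" for F
    using finite_subset[OF that finite_atLeastLessThan] that
  proof (induction F rule: finite_induct)
    case empty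
    then show ?case using finsum_empty ij by (auto simp: module_mat_simps)
  next
    case (insert c F)
    have "finsum ?M ?f (insert c F) = ?f c \<oplus>\<^bsub>?M\<^esub> finsum ?M ?f F"
      using insert f by (intro finsum_insert) (auto simp: module_mat_simps)
    then show ?case using insert f ij by (auto simp: module_mat_simps)
  qed
  from this[of "{0..<2 ^ n}"]
  have "ucg n m U $$ (i, j) = (\<Sum>c = 0..<2 ^ n. ?f c $$ (i, j))"
    by (simp add: ucg_def)
  also have "\<dots> = (\<Sum>c = 0..<2 ^ n. if c = i div 2 ^ m then
      (if i div 2 ^ m = j div 2 ^ m then U (i div 2 ^ m) $$ (i mod 2 ^ m, j mod 2 ^ m) else 0) else 0)"
  proof (rule sum.cong, rule refl)
    fix c :: nat assume "c \<in> {0..<2 ^ n}"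
    then have "U c \<in> carrier_mat (2 ^ m) (2 ^ m)" using U by auto
    moreover have "i div 2 ^ m < 2 ^ n" "j div 2 ^ m < 2 ^ n"
      using ij by (auto simp: less_mult_imp_div_less power_add)
    ultimately show "?f c $$ (i, j) = (if c = i div 2 ^ m then
      (if i div 2 ^ m = j div 2 ^ m then U (i div 2 ^ m) $$ (i mod 2 ^ m, j mod 2 ^ m) else 0) else 0)"
      using ij by (auto simp: tensor_mat_def basis_proj_def power_add)
  qed
  also have "\<dots> = (if i div 2 ^ m = j div 2 ^ m then U (i div 2 ^ m) $$ (i mod 2 ^ m, j mod 2 ^ m) else 0)"
    using ij by (simp add: less_mult_imp_div_less power_add)
  finally show ?thesis .
qed

end

theory Submission
  imports Defs
begin

text \<open>The circuits used permute the control labels and multiply each target block by an element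
  of \<open>\<U>\<close>. Treating the bits \<open>0, \<dots>, k - 1\<close> of the label as selectors and bit \<open>t\<close> as an accumulator,
  the Gray code words \<open>v\<^sub>0 = CU\<close>, \<open>v\<^sub>k\<^sub>+\<^sub>1 = v\<^sub>k CNOT(k, t) v\<^sub>k\<close> can realise any prescribed ratio
  \<open>g\<close> between the phases for accumulator values \<open>1\<close> and \<open>0\<close>: the second copy of
  \<open>v\<^sub>k\<close> contributes its ratio with exponent \<open>\<plusminus>1\<close> according to bit \<open>k\<close>, so splitting \<open>g\<close> between the
  two copies amounts to extracting square roots. Since \<open>v\<^sub>k\<close> leaves bit \<open>k - 1\<close> added to the
  accumulator, one more CNOT restores it when \<open>k > 0\<close>. What remains of the gate no longer
  depends on bit \<open>t\<close>, and one concludes by induction on the number of controls.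
  Bits are numbered by significance, so bit \<open>p\<close> is control qubit \<open>n - 1 - p\<close>.\<close>

section \<open>Block permutation matrices\<close>

text \<open>With \<open>c\<close> a label and \<open>b\<close> a target basis index, this sends
  |c>|b> to |\<open>\<sigma> c\<close>> tensor \<open>A c\<close> |b>. Blocks are indexed by the
  input (column) label, so products read off the order in which gates act.\<close>

definition block_mat :: "nat \<Rightarrow> nat \<Rightarrow> (nat \<Rightarrow> nat) \<Rightarrow> (nat \<Rightarrow> complex mat) \<Rightarrow> complex mat" where
  "block_mat n m \<sigma> A = mat (2 ^ (n + m)) (2 ^ (n + m))
     (\<lambda>(i, j). if i div 2 ^ m = \<sigma> (j div 2 ^ m)
       then A (j div 2 ^ m) $$ (i mod 2 ^ m, j mod 2 ^ m) else 0)"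

lemma block_mat_carrier [simp]: "block_mat n m \<sigma> A \<in> carrier_mat (2 ^ (n + m)) (2 ^ (n + m))"
  by (simp add: block_mat_def)

lemma label_less: "i < 2 ^ (n + m) \<Longrightarrow> i div 2 ^ m < (2::nat) ^ n"
  by (simp add: less_mult_imp_div_less power_add)

lemma block_mat_cong:
  assumes "\<And>c. c < 2 ^ n \<Longrightarrow> \<sigma> c = \<tau> c" "\<And>c. c < 2 ^ n \<Longrightarrow> A c = B c"
  shows "block_mat n m \<sigma> A = block_mat n m \<tau> B"
  using assms by (intro eq_matI) (auto simp: block_mat_def label_less)

text \<open>The right factor acts first and moves label \<open>c\<close> to \<open>\<tau> c\<close>,
  which is the label the left factor then sees. Multiplying gates thus becomes composing label maps
  and multiplying blocks pointwise.\<close>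

lemma block_mat_mult:
  assumes A: "\<And>c. A c \<in> carrier_mat (2 ^ m) (2 ^ m)" and B: "\<And>c. B c \<in> carrier_mat (2 ^ m) (2 ^ m)"
    and \<tau>: "\<And>c. c < 2 ^ n \<Longrightarrow> \<tau> c < 2 ^ n"
  shows "block_mat n m \<sigma> A * block_mat n m \<tau> B = block_mat n m (\<lambda>c. \<sigma> (\<tau> c)) (\<lambda>c. A (\<tau> c) * B c)"
proof (rule eq_matI)
  fix i j
  assume "i < dim_row (block_mat n m (\<lambda>c. \<sigma> (\<tau> c)) (\<lambda>c. A (\<tau> c) * B c))"
    and "j < dim_col (block_mat n m (\<lambda>c. \<sigma> (\<tau> c)) (\<lambda>c. A (\<tau> c) * B c))"
  then have ij: "i < 2 ^ (n + m)" "j < 2 ^ (n + m)" by (simp_all add: block_mat_def)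
  define c where "c = j div 2 ^ m"
  have c: "c < 2 ^ n" using ij label_less c_def by auto
  let ?M = "2 ^ m :: nat"
  let ?f = "\<lambda>l. (if i div ?M = \<sigma> (l div ?M) then A (l div ?M) $$ (i mod ?M, l mod ?M) else 0) *
     (if l div ?M = \<tau> c then B c $$ (l mod ?M, j mod ?M) else 0)"
  have "\<tau> c * ?M + b < 2 ^ (n + m)" if "b < ?M" for b
  proof -
    have "\<tau> c * ?M + b < Suc (\<tau> c) * ?M" using that by simp
    also have "\<dots> \<le> 2 ^ n * ?M" using \<tau>[OF c] by (intro mult_right_mono) auto
    finally show ?thesis by (simp add: power_add)
  qed
  then have sub: "(\<lambda>b. \<tau> c * ?M + b) ` {0..<?M} \<subseteq> {0..<2 ^ (n + m)}" by (intro image_subsetI) simp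
  have "(block_mat n m \<sigma> A * block_mat n m \<tau> B) $$ (i, j) = (\<Sum>l = 0..<2 ^ (n + m). ?f l)"
    using ij by (simp add: block_mat_def scalar_prod_def c_def cong: if_cong)
  \<comment> \<open>The entry of the right factor vanishes unless the intermediate index
    \<open>l\<close> lies in block \<open>\<tau> c\<close>, so the sum shrinks to that
    block.\<close>
  also have "\<dots> = (\<Sum>l \<in> (\<lambda>b. \<tau> c * ?M + b) ` {0..<?M}. ?f l)"
  proof (rule sum.mono_neutral_right[OF _ sub])
    show "\<forall>l\<in>{0..<2 ^ (n + m)} - (\<lambda>b. \<tau> c * ?M + b) ` {0..<?M}. ?f l = 0"
    proof
      fix l assume "l \<in> {0..<2 ^ (n + m)} - (\<lambda>b. \<tau> c * ?M + b) ` {0..<?M}"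
      moreover have "l = l div ?M * ?M + l mod ?M" "l mod ?M \<in> {0..<?M}"
        by (simp_all only: div_mult_mod_eq) simp
      ultimately have "l div ?M \<noteq> \<tau> c" by (metis DiffD2 image_eqI)
      then show "?f l = 0" by simp
    qed
  qed simp
  also have "\<dots> = (\<Sum>b = 0..<?M. ?f (\<tau> c * ?M + b))"
    by (subst sum.reindex) (auto simp: inj_on_def)
  also have "\<dots> = (\<Sum>b = 0..<?M. if i div ?M = \<sigma> (\<tau> c)
      then A (\<tau> c) $$ (i mod ?M, b) * B c $$ (b, j mod ?M) else 0)"
    by (intro sum.cong) auto
  also have "\<dots> = block_mat n m (\<lambda>c. \<sigma> (\<tau> c)) (\<lambda>c. A (\<tau> c) * B c) $$ (i, j)"
    using ij A[of "\<tau> c"] B[of c] by (auto simp: block_mat_def scalar_prod_def c_def)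
  finally show "(block_mat n m \<sigma> A * block_mat n m \<tau> B) $$ (i, j) =
    block_mat n m (\<lambda>c. \<sigma> (\<tau> c)) (\<lambda>c. A (\<tau> c) * B c) $$ (i, j)" .
qed (auto simp: block_mat_def)

section \<open>Uniformly controlled gates and elementary gates in block form\<close>

lemma ucg_eq_block_mat:
  assumes "\<And>c. c < 2 ^ n \<Longrightarrow> U c \<in> carrier_mat (2 ^ m) (2 ^ m)"
  shows "ucg n m U = block_mat n m (\<lambda>c. c) U"
  using ucg_carrier[of n U m] assms
  by (intro eq_matI) (auto simp: block_mat_def ucg_index)

lemma gate_mat_UG:
  assumes "V \<in> carrier_mat (2 ^ m) (2 ^ m)"
  shows "gate_mat n m (UG V) = block_mat n m (\<lambda>c. c) (\<lambda>_. V)"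
  using assms
  by (intro eq_matI) (auto simp: block_mat_def tensor_mat_def power_add label_less less_mult_imp_div_less)

lemma gate_mat_CU:
  assumes "V \<in> carrier_mat (2 ^ m) (2 ^ m)" "p < n"
  shows "gate_mat n m (CU (n - 1 - p) V) =
    block_mat n m (\<lambda>c. c) (\<lambda>c. if bit c p then V else 1\<^sub>m (2 ^ m))"
proof -
  have "n - Suc (n - Suc p) = p" using assms by simp
  then show ?thesis
    using assms
    by (intro eq_matI)
       (auto simp: block_mat_def tensor_mat_def qubit_proj_def qubit_def power_add less_mult_imp_div_less)
qed

text \<open>The low \<open>m\<close> bits hold the target register, so a flip at position
  \<open>m + q\<close> is seen by the control label only, as a flip at \<open>q\<close>.\<close>

lemma flip_bit_add_div: "flip_bit (m + q) j div 2 ^ m = flip_bit q (j div 2 ^ m)" for j :: nat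
  by (rule bit_eqI) (auto simp: bit_simps simp flip: drop_bit_eq_div)

lemma flip_bit_add_mod: "flip_bit (m + q) j mod 2 ^ m = j mod 2 ^ m" for j :: nat
  by (rule bit_eqI) (auto simp: bit_simps simp flip: take_bit_eq_mod)

definition cnot :: "nat \<Rightarrow> nat \<Rightarrow> nat \<Rightarrow> nat" where
  "cnot p q c = (if bit c p then flip_bit q c else c)"

lemma eq_iff_div_mod_eq: "i = j \<longleftrightarrow> i div k = j div k \<and> i mod k = j mod k" for i j k :: nat
  by (metis div_mult_mod_eq)

lemma gate_mat_CNOT:
  assumes "p < n" "q < n"
  shows "gate_mat n m (CNOT (n - 1 - p) (n - 1 - q)) = block_mat n m (cnot p q) (\<lambda>_. 1\<^sub>m (2 ^ m))"
proof -
  \<comment> \<open>Qubits count from the most significant end of all \<open>n + m\<close> bits, so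
    control qubit \<open>n - 1 - p\<close> sits at bit \<open>m + p\<close> of the full
    index.\<close>
  have e: "n + m - Suc (n - Suc p) = m + p" "n + m - Suc (n - Suc q) = m + q" using assms by auto
  have "bit (j div 2 ^ m) p = bit j (m + p)" for j :: nat
    by (simp add: bit_drop_bit_eq flip: drop_bit_eq_div)
  then have div_mod: "(if bit j (m + p) then flip_bit (m + q) j else j) div 2 ^ m = cnot p q (j div 2 ^ m)"
    "(if bit j (m + p) then flip_bit (m + q) j else j) mod 2 ^ m = j mod 2 ^ m" for j :: nat
    by (auto simp: cnot_def flip_bit_add_div flip_bit_add_mod)
  have *: "i = (if bit j (m + p) then flip_bit (m + q) j else j) \<longleftrightarrow>
      i div 2 ^ m = cnot p q (j div 2 ^ m) \<and> i mod 2 ^ m = j mod 2 ^ m" for i j :: nat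
    unfolding eq_iff_div_mod_eq[of i _ "2 ^ m"] div_mod ..
  show ?thesis
  proof (rule eq_matI)
    fix i j
    assume "i < dim_row (block_mat n m (cnot p q) (\<lambda>_. 1\<^sub>m (2 ^ m)))"
      "j < dim_col (block_mat n m (cnot p q) (\<lambda>_. 1\<^sub>m (2 ^ m)))"
    then have ij: "i < 2 ^ (n + m)" "j < 2 ^ (n + m)" by (simp_all add: block_mat_def)
    then have "gate_mat n m (CNOT (n - 1 - p) (n - 1 - q)) $$ (i, j) =
        (if i = (if bit j (m + p) then flip_bit (m + q) j else j) then 1 else 0)"
      by (simp add: qubit_def flip_qubit_def e)
    also have "\<dots> = block_mat n m (cnot p q) (\<lambda>_. 1\<^sub>m (2 ^ m)) $$ (i, j)"
      unfolding * using ij by (simp add: block_mat_def)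
    finally show "gate_mat n m (CNOT (n - 1 - p) (n - 1 - q)) $$ (i, j) =
      block_mat n m (cnot p q) (\<lambda>_. 1\<^sub>m (2 ^ m)) $$ (i, j)" .
  qed (simp_all add: block_mat_def)
qed

lemma circuit_mat_append:
  assumes "\<And>g. g \<in> set (gs @ hs) \<Longrightarrow> gate_mat n m g \<in> carrier_mat (2 ^ (n + m)) (2 ^ (n + m))"
  shows "circuit_mat n m (gs @ hs) = circuit_mat n m gs * circuit_mat n m hs"
proof -
  have carrier: "circuit_mat n m gs \<in> carrier_mat (2 ^ (n + m)) (2 ^ (n + m))"
    if "\<And>g. g \<in> set gs \<Longrightarrow> gate_mat n m g \<in> carrier_mat (2 ^ (n + m)) (2 ^ (n + m))" for gs
    using that by (induction gs) (auto simp: circuit_mat_def intro!: mult_carrier_mat)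
  have hs: "circuit_mat n m hs \<in> carrier_mat (2 ^ (n + m)) (2 ^ (n + m))"
    using assms by (intro carrier) auto
  show ?thesis using assms
  proof (induction gs)
    case Nil
    then show ?case using hs by (simp add: circuit_mat_def)
  next
    case (Cons g gs)
    have "circuit_mat n m (g # gs @ hs) = gate_mat n m g * (circuit_mat n m gs * circuit_mat n m hs)"
      using Cons by (simp add: circuit_mat_def)
    also have "\<dots> = gate_mat n m g * circuit_mat n m gs * circuit_mat n m hs"
      using Cons.prems hs carrier[of gs] by (intro assoc_mult_mat[symmetric]) auto
    finally show ?case by (simp add: circuit_mat_def)
  qed
qed

section \<open>Synthesis\<close>

context comm_group
begin

lemma inv_mult_rearrange:
  assumes "a \<in> carrier G" "b \<in> carrier G" "c \<in> carrier G" "e \<in> carrier G"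
  shows "(inv a \<otimes> b) \<otimes> ((a \<otimes> c) \<otimes> e) = c \<otimes> (b \<otimes> e)"
proof -
  have "(inv a \<otimes> b) \<otimes> ((a \<otimes> c) \<otimes> e) = (inv a \<otimes> a) \<otimes> (c \<otimes> (b \<otimes> e))"
    using assms by (simp only: m_ac m_closed inv_closed)
  then show ?thesis using assms by simp
qed

lemma mult_inv_rearrange:
  assumes "a \<in> carrier G" "b \<in> carrier G"
  shows "a \<otimes> (b \<otimes> inv a) = b"
proof -
  have "a \<otimes> (b \<otimes> inv a) = b \<otimes> (a \<otimes> inv a)"
    using assms by (simp only: m_ac m_closed inv_closed)
  then show ?thesis using assms by simp
qed

text \<open>This is where square roots enter: with \<open>h\<close> a root of the quotient of
  \<open>a\<close> by \<open>b\<close>, the single element \<open>a \<otimes> inv h\<close> yields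
  \<open>a\<close> when multiplied by \<open>h\<close> and \<open>b\<close> when multiplied by
  \<open>inv h\<close>.\<close>

lemma inv_mult_inv_of_square:
  assumes "h \<in> carrier G" "a \<in> carrier G" "b \<in> carrier G" "h \<otimes> h = a \<otimes> inv b"
  shows "inv h \<otimes> (a \<otimes> inv h) = b"
proof -
  have "inv h \<otimes> (a \<otimes> inv h) = a \<otimes> inv (h \<otimes> h)"
    using assms(1-3) by (simp add: inv_mult m_ac)
  also have "\<dots> = a \<otimes> (b \<otimes> inv a)"
    using assms by (simp add: inv_mult_group)
  also have "\<dots> = b" using assms mult_inv_rearrange by blast
  finally show ?thesis .
qed

end

section \<open>Circuits over a target family, with gate counts\<close>

locale family =
  fixes n m :: nat and \<U> :: "complex mat set"
  assumes target_family: "target_family m \<U>"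
begin

definition G :: "complex mat monoid" where
  "G = (unitary_group (2 ^ m))\<lparr>carrier := \<U>\<rparr>"

lemma family_carrier: "\<U> \<subseteq> carrier_mat (2 ^ m) (2 ^ m)"
  using target_family unfolding target_family_def
  by (auto dest!: subgroup.subset simp: unitary_group_def)

sublocale comm_group G
proof -
  have "group G"
    using target_family group_unitary_group
    by (auto simp: target_family_def G_def intro: subgroup.subgroup_is_group)
  then show "comm_group G"
    using target_family
    by (intro group.group_comm_groupI) (auto simp: target_family_def unitary_group_def G_def)
qed

lemma carrier_G: "carrier G = \<U>" and mult_G: "A \<otimes>\<^bsub>G\<^esub> B = A * B"
  and one_G: "\<one>\<^bsub>G\<^esub> = 1\<^sub>m (2 ^ m)"
  by (simp_all add: unitary_group_def G_def)

text \<open>Membership in the group is demanded of all values of \<open>A\<close>, also beyond the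
  labels below \<open>2 ^ n\<close>, so that group laws apply pointwise without bounds.\<close>

definition synth :: "nat \<Rightarrow> nat \<Rightarrow> nat \<Rightarrow> (nat \<Rightarrow> nat) \<Rightarrow> (nat \<Rightarrow> complex mat) \<Rightarrow> bool" where
  "synth u c x \<sigma> A \<longleftrightarrow>
     (\<forall>l<2 ^ n. \<sigma> l < 2 ^ n) \<and> range A \<subseteq> carrier G \<and>
     (\<exists>gs. (\<forall>g\<in>set gs. valid_gate n m \<U> g) \<and>
       length (filter is_UG gs) = u \<and> length (filter is_CU gs) = c \<and> length (filter is_CNOT gs) = x \<and>
       circuit_mat n m gs = block_mat n m \<sigma> A)"

lemma synth_comp:
  assumes "synth u c x \<sigma> A" "synth u' c' x' \<tau> B"
  shows "synth (u + u') (c + c') (x + x') (\<lambda>l. \<sigma> (\<tau> l)) (\<lambda>l. A (\<tau> l) \<otimes>\<^bsub>G\<^esub> B l)"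
proof -
  obtain gs where gs: "\<forall>g\<in>set gs. valid_gate n m \<U> g"
    "length (filter is_UG gs) = u" "length (filter is_CU gs) = c" "length (filter is_CNOT gs) = x"
    "circuit_mat n m gs = block_mat n m \<sigma> A"
    using assms(1) by (auto simp: synth_def)
  obtain hs where hs: "\<forall>g\<in>set hs. valid_gate n m \<U> g"
    "length (filter is_UG hs) = u'" "length (filter is_CU hs) = c'" "length (filter is_CNOT hs) = x'"
    "circuit_mat n m hs = block_mat n m \<tau> B"
    using assms(2) by (auto simp: synth_def)
  have AB: "A l \<in> carrier G" "B l \<in> carrier G" for l
    using assms by (auto simp: synth_def)
  have label: "\<sigma> l < 2 ^ n" "\<tau> l < 2 ^ n" if "l < 2 ^ n" for l
    using assms that by (simp_all add: synth_def)
  have "circuit_mat n m (gs @ hs) = circuit_mat n m gs * circuit_mat n m hs"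
    using gs(1) hs(1) gate_mat_carrier[OF family_carrier] by (intro circuit_mat_append) auto
  also have "\<dots> = block_mat n m (\<lambda>l. \<sigma> (\<tau> l)) (\<lambda>l. A (\<tau> l) \<otimes>\<^bsub>G\<^esub> B l)"
    unfolding mult_G gs(5) hs(5) using AB family_carrier label
    by (intro block_mat_mult) (auto simp: carrier_G)
  finally have "circuit_mat n m (gs @ hs) = block_mat n m (\<lambda>l. \<sigma> (\<tau> l)) (\<lambda>l. A (\<tau> l) \<otimes>\<^bsub>G\<^esub> B l)" .
  then show ?thesis
    using AB label gs(1-4) hs(1-4) unfolding synth_def by (intro conjI exI[of _ "gs @ hs"]) auto
qed

lemma synth_single:
  assumes "valid_gate n m \<U> g" "gate_mat n m g = block_mat n m \<sigma> A"
    and "\<And>l. l < 2 ^ n \<Longrightarrow> \<sigma> l < 2 ^ n" "\<And>l. A l \<in> carrier G"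
  shows "synth (of_bool (is_UG g)) (of_bool (is_CU g)) (of_bool (is_CNOT g)) \<sigma> A"
proof -
  have "circuit_mat n m [g] = block_mat n m \<sigma> A"
    by (simp add: circuit_mat_def assms(2) right_mult_one_mat[OF block_mat_carrier])
  then show ?thesis
    unfolding synth_def using assms(1,3,4) by (intro conjI exI[of _ "[g]"]) auto
qed

lemma synth_UG:
  assumes "V \<in> carrier G"
  shows "synth 1 0 0 (\<lambda>l. l) (\<lambda>_. V)"
proof -
  have "gate_mat n m (UG V) = block_mat n m (\<lambda>l. l) (\<lambda>_. V)"
    using assms family_carrier by (intro gate_mat_UG) (auto simp: carrier_G)
  from synth_single[OF _ this] show ?thesis using assms by (simp add: carrier_G)
qed

lemma synth_CU:
  assumes "V \<in> carrier G" "p < n"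
  shows "synth 0 1 0 (\<lambda>l. l) (\<lambda>l. if bit l p then V else \<one>\<^bsub>G\<^esub>)"
proof -
  have "gate_mat n m (CU (n - 1 - p) V) = block_mat n m (\<lambda>l. l) (\<lambda>l. if bit l p then V else \<one>\<^bsub>G\<^esub>)"
    unfolding one_G using assms family_carrier by (intro gate_mat_CU) (auto simp: carrier_G)
  from synth_single[OF _ this] show ?thesis using assms one_closed by (simp add: carrier_G)
qed

lemma cnot_less:
  assumes "q < n" "l < 2 ^ n"
  shows "cnot p q l < 2 ^ n"
proof -
  \<comment> \<open>Being below \<open>2 ^ n\<close> is obtained as invariance under
    \<open>take_bit n\<close>, which a flip at \<open>q < n\<close> preserves.\<close>
  have "take_bit n (flip_bit q l) = flip_bit q l"
    using assms(1) by (simp only: take_bit_flip_bit_eq take_bit_nat_eq_self[OF assms(2)]) simp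
  then have "flip_bit q l < 2 ^ n" by (metis take_bit_nat_less_exp)
  then show ?thesis using assms by (simp add: cnot_def)
qed

lemma synth_CNOT:
  assumes "p < n" "q < n" "p \<noteq> q"
  shows "synth 0 0 1 (cnot p q) (\<lambda>_. \<one>\<^bsub>G\<^esub>)"
proof -
  have "gate_mat n m (CNOT (n - 1 - p) (n - 1 - q)) = block_mat n m (cnot p q) (\<lambda>_. \<one>\<^bsub>G\<^esub>)"
    unfolding one_G using assms by (intro gate_mat_CNOT)
  moreover have "valid_gate n m \<U> (CNOT (n - 1 - p) (n - 1 - q))" using assms by auto
  ultimately show ?thesis
    using synth_single[of "CNOT (n - 1 - p) (n - 1 - q)"] cnot_less[OF assms(2)] one_closed by simp
qed

section \<open>Gray code words with prescribed phase ratio\<close>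

lemma square_root:
  assumes "A \<in> carrier G"
  obtains V where "V \<in> carrier G" "V \<otimes>\<^bsub>G\<^esub> V = A"
  using assms target_family unfolding target_family_def mult_G carrier_G by blast

text \<open>The effect of the word \<open>v\<^sub>k\<close> on the control label.\<close>

definition residue :: "nat \<Rightarrow> nat \<Rightarrow> nat \<Rightarrow> nat" where
  "residue k t l = (if k = 0 then l else cnot (k - 1) t l)"

text \<open>Only the ratio \<open>g\<close> is prescribed. The factor \<open>P\<close> common to
  both accumulator values is an uncontrolled by-product, but it depends on the selector bits alone
  and can be cancelled later.\<close>

lemma synth_gray_code:
  assumes "k \<le> t" "t < n" and "\<And>y. g y \<in> carrier G"
  shows "\<exists>P. (\<forall>y. P y \<in> carrier G) \<and>
    synth 0 (2 ^ k) (2 ^ k - 1) (residue k t)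
      (\<lambda>l. if bit l t then g (take_bit k l) \<otimes>\<^bsub>G\<^esub> P (take_bit k l) else P (take_bit k l))"
  using assms
proof (induction k arbitrary: g)
  case 0
  then have "synth 0 1 0 (\<lambda>l. l) (\<lambda>l. if bit l t then g 0 else \<one>\<^bsub>G\<^esub>)"
    by (intro synth_CU) auto
  moreover have "residue 0 t = (\<lambda>l. l)" by (auto simp: residue_def)
  ultimately show ?case
    using 0 by (intro exI[of _ "\<lambda>_. \<one>\<^bsub>G\<^esub>"]) (simp add: r_one cong: if_cong)
next
  case (Suc k)
  \<comment> \<open>The bit that the first copy leaves added to the accumulator. The guard is needed
    because \<open>k - 1\<close> is \<open>0\<close> at \<open>k = 0\<close>, where nothing is
    added.\<close>
  define s where "s = (\<lambda>y::nat. k \<noteq> 0 \<and> bit y (k - 1))"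
  have "\<exists>h. \<forall>y. h y \<in> carrier G \<and> h y \<otimes>\<^bsub>G\<^esub> h y = g y \<otimes>\<^bsub>G\<^esub> inv\<^bsub>G\<^esub> g (set_bit k y)"
    using square_root Suc.prems(3) by (intro choice allI) (metis inv_closed m_closed)
  then obtain h where h: "\<And>y. h y \<in> carrier G"
    "\<And>y. h y \<otimes>\<^bsub>G\<^esub> h y = g y \<otimes>\<^bsub>G\<^esub> inv\<^bsub>G\<^esub> g (set_bit k y)" by blast
  define g1 where "g1 = (\<lambda>y. g y \<otimes>\<^bsub>G\<^esub> inv\<^bsub>G\<^esub> h y)"
  \<comment> \<open>The sign compensates for \<open>s\<close>, so that the exponent of
    \<open>h\<close> in the total ratio is decided by bit \<open>k\<close> alone.\<close>
  define g2 where "g2 = (\<lambda>y. if s y then inv\<^bsub>G\<^esub> h y else h y)"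
  have g12: "g1 y \<in> carrier G" "g2 y \<in> carrier G" for y
    using h Suc.prems(3) unfolding g1_def g2_def by auto
  obtain P1 where P1: "\<And>y. P1 y \<in> carrier G" "synth 0 (2 ^ k) (2 ^ k - 1) (residue k t)
      (\<lambda>l. if bit l t then g1 (take_bit k l) \<otimes>\<^bsub>G\<^esub> P1 (take_bit k l) else P1 (take_bit k l))"
    using Suc.IH[of g1] Suc.prems g12 by auto
  obtain P2 where P2: "\<And>y. P2 y \<in> carrier G" "synth 0 (2 ^ k) (2 ^ k - 1) (residue k t)
      (\<lambda>l. if bit l t then g2 (take_bit k l) \<otimes>\<^bsub>G\<^esub> P2 (take_bit k l) else P2 (take_bit k l))"
    using Suc.IH[of g2] Suc.prems g12 by auto
  \<comment> \<open>The total phase at accumulator value 0: the second copy contributes its ratio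
    exactly when it sees a flipped accumulator.\<close>
  define P where "P = (\<lambda>y. (if s y \<noteq> bit y k
      then g2 (take_bit k y) \<otimes>\<^bsub>G\<^esub> P2 (take_bit k y) else P2 (take_bit k y)) \<otimes>\<^bsub>G\<^esub> P1 (take_bit k y))"
  have P: "P y \<in> carrier G" for y
    unfolding P_def using P1(1) P2(1) g12 by (auto intro!: m_closed)
  have key: "g (take_bit (Suc k) l) = (if s l \<noteq> bit l k then inv\<^bsub>G\<^esub> g2 (take_bit k l)
      else g2 (take_bit k l)) \<otimes>\<^bsub>G\<^esub> g1 (take_bit k l)" for l
  proof -
    let ?x = "take_bit k l"
    have "take_bit (Suc k) l = (if bit l k then set_bit k ?x else ?x)"
      by (auto intro!: bit_eqI simp: bit_simps less_Suc_eq)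
    moreover have "s ?x = s l" by (auto simp: s_def bit_simps)
    moreover have "h ?x \<otimes>\<^bsub>G\<^esub> g1 ?x = g ?x"
      using h Suc.prems(3) mult_inv_rearrange by (simp add: g1_def)
    moreover have "inv\<^bsub>G\<^esub> h ?x \<otimes>\<^bsub>G\<^esub> g1 ?x = g (set_bit k ?x)"
      using h Suc.prems(3) inv_mult_inv_of_square by (simp add: g1_def)
    ultimately show ?thesis using h by (auto simp: g2_def)
  qed
  have P_take_bit: "P (take_bit (Suc k) l) = (if s l \<noteq> bit l k
      then g2 (take_bit k l) \<otimes>\<^bsub>G\<^esub> P2 (take_bit k l) else P2 (take_bit k l)) \<otimes>\<^bsub>G\<^esub> P1 (take_bit k l)" for l
  proof -
    have "take_bit k (take_bit (Suc k) l) = take_bit k l" "s (take_bit (Suc k) l) = s l"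
      "bit (take_bit (Suc k) l) k = bit l k"
      by (auto simp: s_def bit_simps)
    then show ?thesis by (simp add: P_def)
  qed
  \<comment> \<open>The label on which the second copy acts, after the first copy and the CNOT from
    bit \<open>k\<close>.\<close>
  let ?\<tau> = "\<lambda>l. cnot k t (residue k t l)"
  have \<tau>_take_bit: "take_bit k (?\<tau> l) = take_bit k l" for l
    using Suc.prems by (auto intro!: bit_eqI simp: residue_def cnot_def bit_simps)
  have \<tau>_bit: "bit (?\<tau> l) t = (bit l t \<noteq> (s l \<noteq> bit l k))" for l
    using Suc.prems by (auto simp: residue_def cnot_def s_def bit_simps)
  \<comment> \<open>Both copies add bit \<open>k - 1\<close> to the accumulator, which cancels; only
    the addition of bit \<open>k\<close> remains.\<close>
  have \<tau>_residue: "residue k t (?\<tau> l) = residue (Suc k) t l" for l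
    using Suc.prems by (auto intro!: bit_eqI simp: residue_def cnot_def bit_simps)
  let ?A = "\<lambda>l. (if bit (?\<tau> l) t then g2 (take_bit k (?\<tau> l)) \<otimes>\<^bsub>G\<^esub> P2 (take_bit k (?\<tau> l))
        else P2 (take_bit k (?\<tau> l))) \<otimes>\<^bsub>G\<^esub> (\<one>\<^bsub>G\<^esub> \<otimes>\<^bsub>G\<^esub>
        (if bit l t then g1 (take_bit k l) \<otimes>\<^bsub>G\<^esub> P1 (take_bit k l) else P1 (take_bit k l)))"
  have "synth (0 + (0 + 0)) (2 ^ k + (0 + 2 ^ k)) (2 ^ k - 1 + (1 + (2 ^ k - 1)))
      (\<lambda>l. residue k t (?\<tau> l)) ?A"
    using Suc.prems by (intro synth_comp P2(2) P1(2) synth_CNOT) auto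
  moreover have "2 ^ k - 1 + (1 + (2 ^ k - 1)) = 2 ^ Suc k - (1::nat)"
    by (simp add: algebra_simps)
  moreover have "?A l = (if bit l t then g (take_bit (Suc k) l) \<otimes>\<^bsub>G\<^esub> P (take_bit (Suc k) l)
      else P (take_bit (Suc k) l))" for l
    unfolding key P_take_bit \<tau>_take_bit \<tau>_bit
    using P1(1) P2(1) g12 by (auto simp: inv_mult_rearrange m_ac)
  ultimately have "synth 0 (2 ^ Suc k) (2 ^ Suc k - 1) (residue (Suc k) t)
      (\<lambda>l. if bit l t then g (take_bit (Suc k) l) \<otimes>\<^bsub>G\<^esub> P (take_bit (Suc k) l)
        else P (take_bit (Suc k) l))"
    by (simp add: \<tau>_residue mult_2)
  then show ?case using P by (intro exI[of _ P]) auto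
qed

text \<open>The residue is itself a CNOT, hence an involution undone by one more CNOT. For
  \<open>k = 0\<close> there is none to undo, hence the case distinction in the count.\<close>

lemma synth_gray_code_restored:
  assumes "k < n" and g: "\<And>y. g y \<in> carrier G"
  shows "\<exists>P. (\<forall>y. P y \<in> carrier G) \<and> synth 0 (2 ^ k) (if k = 0 then 0 else 2 ^ k) (\<lambda>l. l)
      (\<lambda>l. if bit l k then g (take_bit k l) \<otimes>\<^bsub>G\<^esub> P (take_bit k l) else P (take_bit k l))"
proof -
  obtain P where P: "\<And>y. P y \<in> carrier G" "synth 0 (2 ^ k) (2 ^ k - 1) (residue k k)
      (\<lambda>l. if bit l k then g (take_bit k l) \<otimes>\<^bsub>G\<^esub> P (take_bit k l) else P (take_bit k l))"
    using synth_gray_code[of k k g] assms by auto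
  show ?thesis
  proof (cases "k = 0")
    case True
    moreover have "residue 0 0 = (\<lambda>l. l)" by (auto simp: residue_def)
    ultimately show ?thesis using P by (intro exI[of _ P]) auto
  next
    case False
    have "synth 0 0 1 (cnot (k - 1) k) (\<lambda>_. \<one>\<^bsub>G\<^esub>)"
      using assms False by (intro synth_CNOT) auto
    from synth_comp[OF this P(2)]
    have "synth 0 (2 ^ k) (2 ^ k) (\<lambda>l. cnot (k - 1) k (residue k k l))
      (\<lambda>l. if bit l k then g (take_bit k l) \<otimes>\<^bsub>G\<^esub> P (take_bit k l) else P (take_bit k l))"
      using g P(1) by (simp add: if_distrib[of "\<lambda>a. \<one>\<^bsub>G\<^esub> \<otimes>\<^bsub>G\<^esub> a"] cong: if_cong)
    moreover have "cnot (k - 1) k (residue k k l) = l" for l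
      using False by (auto intro!: bit_eqI simp: residue_def cnot_def bit_simps)
    ultimately show ?thesis using P False by (intro exI[of _ P]) auto
  qed
qed

text \<open>The highest relevant bit serves as accumulator and is peeled off. The counts are the
  sums of \<open>2 ^ j\<close> over \<open>j < k\<close> for CU and over \<open>0 < j < k\<close>
  for CNOT, plus the single unconditional gate at the base.\<close>

lemma synth_diagonal:
  assumes "k \<le> n" and "\<And>y. f y \<in> carrier G"
  shows "synth 1 (2 ^ k - 1) (2 ^ k - 2) (\<lambda>l. l) (\<lambda>l. f (take_bit k l))"
  using assms
proof (induction k arbitrary: f)
  case 0
  then show ?case using synth_UG[of "f 0"] by simp
next
  case (Suc k)
  define g where "g = (\<lambda>y. f (set_bit k y) \<otimes>\<^bsub>G\<^esub> inv\<^bsub>G\<^esub> f y)"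
  have g: "g y \<in> carrier G" for y using Suc.prems by (simp add: g_def)
  obtain P where P: "\<And>y. P y \<in> carrier G"
    "synth 0 (2 ^ k) (if k = 0 then 0 else 2 ^ k) (\<lambda>l. l)
      (\<lambda>l. if bit l k then g (take_bit k l) \<otimes>\<^bsub>G\<^esub> P (take_bit k l) else P (take_bit k l))"
    using synth_gray_code_restored[of k g] Suc.prems g by auto
  \<comment> \<open>The by-product \<open>P\<close> depends only on the lower bits, so its inverse
    is absorbed into the smaller diagonal gate.\<close>
  have "synth 1 (2 ^ k - 1) (2 ^ k - 2) (\<lambda>l. l) (\<lambda>l. f (take_bit k l) \<otimes>\<^bsub>G\<^esub> inv\<^bsub>G\<^esub> P (take_bit k l))"
    using Suc.IH[of "\<lambda>y. f y \<otimes>\<^bsub>G\<^esub> inv\<^bsub>G\<^esub> P y"] Suc.prems P(1) by auto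
  note synth_comp[OF this P(2)]
  moreover have "2 ^ k - 1 + 2 ^ k = 2 ^ Suc k - (1::nat)" by (simp add: algebra_simps)
  \<comment> \<open>Truncated subtraction makes \<open>2 ^ k - 2\<close> equal to \<open>0\<close>
    at \<open>k = 0\<close>, matching the absent CNOT.\<close>
  moreover have "2 ^ k - 2 + (if k = 0 then 0 else 2 ^ k) = 2 ^ Suc k - (2::nat)"
    by (cases k) auto
  moreover have "f (take_bit k l) \<otimes>\<^bsub>G\<^esub> inv\<^bsub>G\<^esub> P (take_bit k l) \<otimes>\<^bsub>G\<^esub>
      (if bit l k then g (take_bit k l) \<otimes>\<^bsub>G\<^esub> P (take_bit k l) else P (take_bit k l)) =
      f (take_bit (Suc k) l)" for l
  proof -
    let ?x = "take_bit k l"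
    have "take_bit (Suc k) l = (if bit l k then set_bit k ?x else ?x)"
      by (auto intro!: bit_eqI simp: bit_simps less_Suc_eq)
    moreover have "f ?x \<otimes>\<^bsub>G\<^esub> inv\<^bsub>G\<^esub> P ?x \<otimes>\<^bsub>G\<^esub> P ?x = f ?x"
      using P(1) Suc.prems by (simp add: m_assoc)
    moreover have "f ?x \<otimes>\<^bsub>G\<^esub> inv\<^bsub>G\<^esub> P ?x \<otimes>\<^bsub>G\<^esub> (g ?x \<otimes>\<^bsub>G\<^esub> P ?x) = f (set_bit k ?x)"
    proof -
      have "f ?x \<otimes>\<^bsub>G\<^esub> inv\<^bsub>G\<^esub> P ?x \<otimes>\<^bsub>G\<^esub> (g ?x \<otimes>\<^bsub>G\<^esub> P ?x) =
          f ?x \<otimes>\<^bsub>G\<^esub> g ?x \<otimes>\<^bsub>G\<^esub> (P ?x \<otimes>\<^bsub>G\<^esub> inv\<^bsub>G\<^esub> P ?x)"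
        using P(1) g Suc.prems by (simp only: m_ac m_closed inv_closed)
      then show ?thesis
        using P(1) g Suc.prems mult_inv_rearrange by (simp add: g_def)
    qed
    ultimately show ?thesis by simp
  qed
  ultimately show ?case by simp
qed

end

theorem theorem2:
  fixes n m :: nat and \<U> :: "complex mat set" and U :: "nat \<Rightarrow> complex mat" and L :: "complex mat"
  assumes "n \<ge> 1" and "m \<ge> 1"
    and "target_family m \<U>"
    and "\<And>c. c < 2 ^ n \<Longrightarrow> U c \<in> \<U>"
    and "L = ucg n m U"
  shows "\<exists>gs. (\<forall>g\<in>set gs. valid_gate n m \<U> g) \<and>
    length (filter is_CU gs) = 2 ^ n - 1 \<and>
    length (filter is_UG gs) = 1 \<and>
    length (filter is_CNOT gs) = 2 ^ n - 2 \<and>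
    L = circuit_mat n m gs"
proof -
  interpret family n m \<U> using assms(3) by unfold_locales
  \<comment> \<open>Values beyond the labels are padded with the identity, since
    \<open>synth_diagonal\<close> expects a group element at every argument.\<close>
  define f where "f = (\<lambda>c. if c < 2 ^ n then U c else \<one>\<^bsub>G\<^esub>)"
  have "f c \<in> carrier G" for c using assms(4) one_closed by (auto simp: f_def carrier_G)
  then have "synth 1 (2 ^ n - 1) (2 ^ n - 2) (\<lambda>l. l) (\<lambda>l. f (take_bit n l))"
    by (intro synth_diagonal) auto
  moreover have "L = block_mat n m (\<lambda>l. l) (\<lambda>l. f (take_bit n l))"
    unfolding assms(5) using assms(4) family_carrier
    by (subst ucg_eq_block_mat) (auto intro!: block_mat_cong simp: f_def take_bit_nat_eq_self)
  ultimately show ?thesis unfolding synth_def by metis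
qed

end
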